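(* Let $H$ be a real or complex Hilbert space and let $H_1,\dots,H_n$ be closed subspaces of $H$ such that $H_k\neq\{0\}$ for some $k$. Suppose that the system of subspaces $H_1,\dots,H_n$ possesses the IBAP. Set $$c:=\inf\left\{\dfrac{\|x_1+\dots+x_n\|}{\sqrt{\|x_1\|^2+\dots+\|x_n\|^2}}\ \middle|\ x_1\in H_1,\dots,x_n\in H_n,\ (x_1,\dots,x_n)\neq(0,\dots,0)\right\}.$$ If a system of closed subspaces $H_1',\dots,H_n'$ of $H$ is such that $$(\theta(H_1,H_1'))^2+\dots+(\theta(H_n,H_n'))^2<c^2,$$ then the system $H_1',\dots,H_n'$ also possesses the IBAP.
   Context: A system of closed subspaces $H_1,\dots,H_n$ of $H$, with $P_k$ the orthogonal projection onto $H_k$, possesses the inverse best approximation property (IBAP) if for arbitrary $x_1\in H_1,\dots,x_n\in H_n$ there exists $x\in H$ such that $P_kx=x_k$ for all $k=1,\dots,n$. For closed subspaces $M,N$ of $H$ with orthogonal projections $P,Q$ onto $M,N$ respectively, the opening between $M$ and $N$ is $\theta(M,N):=\|P-Q\|$ (operator norm). *)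

theory Defs
  imports "HOL-Analysis.Analysis"
begin

text \<open>
  The scalar fields are the real numbers with the identity and the complex numbers with
  complex conjugation. Lemma \<open>scalar_real_or_complex\<close> shows that the class admits no others.
\<close>

class scalar_field = real_normed_field +
  fixes conjg :: "'a \<Rightarrow> 'a"
  assumes conjg_add: "conjg (x + y) = conjg x + conjg y"
    and conjg_mult: "conjg (x * y) = conjg x * conjg y"
    and conjg_conjg: "conjg (conjg x) = x"
    and conjg_scaleR_one: "conjg (r *\<^sub>R 1) = r *\<^sub>R 1"
    and mult_conjg_scaleR: "x * conjg x = (norm x)\<^sup>2 *\<^sub>R 1"

lemma conjg_of_real: "conjg (of_real r :: 'k::scalar_field) = of_real r"
  by (simp only: of_real_def conjg_scaleR_one)

lemma mult_conjg: "x * conjg x = of_real ((norm x)\<^sup>2)" for x :: "'k::scalar_field"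
  by (simp only: of_real_def mult_conjg_scaleR)

instantiation real :: scalar_field
begin
definition conjg_real :: "real \<Rightarrow> real" where "conjg_real x = x"
instance
  by standard (simp_all add: conjg_real_def power2_eq_square)
end

instantiation complex :: scalar_field
begin
definition conjg_complex :: "complex \<Rightarrow> complex" where "conjg_complex = cnj"
instance
  by standard (simp_all add: conjg_complex_def scaleR_conv_of_real complex_norm_square[symmetric]
    del: of_real_power)
end

lemma scalar_real_or_complex:
  "(\<forall>z :: 'k::scalar_field. z \<in> \<real>) \<or>
   (\<exists>i :: 'k. i * i = - 1 \<and> conjg i = - i \<and> (\<forall>z. \<exists>a b. z = of_real a + of_real b * i))"
proof -
  have tr: "z + conjg z \<in> \<real>" for z :: 'k
  proof -
    have "(1 + z) * conjg (1 + z) = 1 + (z + conjg z) + z * conjg z"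
      using conjg_of_real[of 1, where 'k = 'k] by (simp add: conjg_add algebra_simps)
    then have "z + conjg z = of_real ((norm (1 + z))\<^sup>2) - 1 - of_real ((norm z)\<^sup>2)"
      by (simp only: mult_conjg) (simp add: algebra_simps)
    also have "\<dots> \<in> \<real>" by (intro Reals_diff Reals_of_real Reals_1)
    finally show ?thesis .
  qed
  have fixed: "z \<in> \<real>" if "conjg z = z" for z :: 'k
  proof -
    have "(z + conjg z) / 2 \<in> \<real>" by (intro Reals_divide tr) simp
    then show ?thesis using that by simp
  qed
  have neg: "conjg (- z) = - conjg z" for z :: 'k
    using conjg_mult[of "of_real (- 1)" z] conjg_of_real[of "- 1", where 'k = 'k] by simp
  have dec: "\<exists>a w. z = of_real a + w \<and> conjg w = - w" for z :: 'k
  proof -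
    obtain s where s: "z + conjg z = of_real s" using tr[of z] by (auto elim: Reals_cases)
    have s2: "conjg z = of_real s - z" using s by (simp add: algebra_simps)
    have e: "of_real s = of_real (s/2) + (of_real (s/2) :: 'k)"
      by (simp add: of_real_add[symmetric] del: of_real_add of_real_divide)
    have "conjg (z + of_real (- (s/2))) = of_real s - z + of_real (- (s/2))"
      by (simp only: conjg_add s2 conjg_of_real)
    also have "\<dots> = - (z + of_real (- (s/2)))"
      unfolding e by (simp add: algebra_simps del: of_real_divide)
    finally have "conjg (z + of_real (- (s/2))) = - (z + of_real (- (s/2)))" .
    moreover have "z = of_real (s/2) + (z + of_real (- (s/2)))" by simp
    ultimately show ?thesis by blast
  qed
  show ?thesis
  proof (cases "\<forall>z :: 'k. z \<in> \<real>")
    case False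
    then obtain z :: 'k where z: "z \<notin> \<real>" by blast
    obtain a y where y: "z = of_real a + y" "conjg y = - y" using dec by blast
    have y0: "y \<noteq> 0" using z y by auto
    define i where "i = of_real (1 / norm y) * y"
    have ci: "conjg i = - i" unfolding i_def conjg_mult conjg_of_real y by simp
    have "norm i = 1" using y0 by (simp add: i_def norm_mult norm_divide)
    then have ii: "i * i = - 1" using mult_conjg[of i] ci
      by (metis minus_mult_right minus_minus of_real_1 power_one)
    have "\<exists>a b. v = of_real a + of_real b * i" for v
    proof -
      obtain a w where w: "v = of_real a + w" "conjg w = - w" using dec by blast
      have "conjg (w * i) = w * i" by (simp add: conjg_mult w ci)
      then obtain r where r: "w * i = of_real r" using fixed by (metis Reals_cases)
      have "w = - (w * (i * i))" using ii by simp
      also have "\<dots> = of_real (- r) * i" using r by (simp add: mult.assoc[symmetric])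
      finally show ?thesis using w by blast
    qed
    then show ?thesis using ii ci by blast
  qed simp
qed

text \<open>
  The topology, the norm and the completeness of the space are those of the type class
  \<^class>\<open>banach\<close>; the last axiom says that the norm is induced by the inner product.
  The inner product is linear in its first argument.
\<close>

locale hilbert_space = vector_space scl
  for scl :: "'k::scalar_field \<Rightarrow> 'a::banach \<Rightarrow> 'a" +
  fixes ip :: "'a \<Rightarrow> 'a \<Rightarrow> 'k"
  assumes scale_of_real: "scl (of_real r) x = r *\<^sub>R x"
    and ip_add_left: "ip (x + y) z = ip x z + ip y z"
    and ip_scale_left: "ip (scl a x) y = a * ip x y"
    and ip_commute: "ip y x = conjg (ip x y)"
    and ip_self: "ip x x = of_real ((norm x)\<^sup>2)"

lemma hilbert_space_real_inner:
  "hilbert_space scaleR (inner :: 'a::{real_inner, banach} \<Rightarrow> 'a \<Rightarrow> real)"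
  by unfold_locales
    (simp_all add: scaleR_add_right scaleR_add_left inner_add_left inner_add_right inner_commute
      conjg_real_def power2_norm_eq_inner)

lemma hilbert_space_complex: "hilbert_space (*) (\<lambda>x y :: complex. x * cnj y)"
  by unfold_locales
    (simp_all add: algebra_simps conjg_complex_def scaleR_conv_of_real
      complex_norm_square[symmetric] del: of_real_power)

definition closed_subspace :: "('k::scalar_field \<Rightarrow> 'a::banach \<Rightarrow> 'a) \<Rightarrow> 'a set \<Rightarrow> bool" where
  "closed_subspace scl M \<longleftrightarrow> module.subspace scl M \<and> closed M"

definition orth_proj :: "('a::banach \<Rightarrow> 'a \<Rightarrow> 'k::scalar_field) \<Rightarrow> 'a set \<Rightarrow> 'a \<Rightarrow> 'a" where
  "orth_proj ip M x = (THE y. y \<in> M \<and> (\<forall>z\<in>M. ip (x - y) z = 0))"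

definition IBAP :: "('a::banach \<Rightarrow> 'a \<Rightarrow> 'k::scalar_field) \<Rightarrow> nat \<Rightarrow> (nat \<Rightarrow> 'a set) \<Rightarrow> bool" where
  "IBAP ip n H \<longleftrightarrow>
     (\<forall>x. (\<forall>k\<in>{1..n}. x k \<in> H k) \<longrightarrow> (\<exists>y. \<forall>k\<in>{1..n}. orth_proj ip (H k) y = x k))"

definition subspace_opening :: "('a::banach \<Rightarrow> 'a \<Rightarrow> 'k::scalar_field) \<Rightarrow> 'a set \<Rightarrow> 'a set \<Rightarrow> real" where
  "subspace_opening ip M N = onorm (\<lambda>x. orth_proj ip M x - orth_proj ip N x)"

end

theory Submission
  imports Defs
begin

text \<open>
  Write \<open>P\<^sub>k\<close> and \<open>P'\<^sub>k\<close> for the projections onto \<open>H\<^sub>k\<close> and \<open>H'\<^sub>k\<close>, \<open>\<theta>\<^sub>k\<close> for the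
  opening between these two subspaces, and \<open>\<delta>\<close> for the square root of the sum of the
  \<open>\<theta>\<^sub>k\<^sup>2\<close>, so that \<open>\<delta> < c\<close>.

  Bounding \<open>\<parallel>\<Sum>\<^sub>k x\<^sub>k\<parallel>\<close> from below for \<open>x\<^sub>k \<in> H'\<^sub>k\<close> by passing to \<open>P\<^sub>k x\<^sub>k\<close> is wasteful: the
  projection shortens \<open>x\<^sub>k\<close>, and the resulting estimate is positive only under a condition
  stronger than \<open>\<delta> < c\<close>.  The proof therefore tests with vectors \<open>a\<^sub>k \<in> H\<^sub>k\<close>.  For these
  \<open>a\<^sub>k = P\<^sub>k a\<^sub>k\<close>, so the triangle and the Cauchy-Schwarz inequality give
  \<open>\<parallel>\<Sum>\<^sub>k P'\<^sub>k a\<^sub>k\<parallel> \<ge> \<parallel>\<Sum>\<^sub>k a\<^sub>k\<parallel> - \<Sum>\<^sub>k \<theta>\<^sub>k \<parallel>a\<^sub>k\<parallel> \<ge> (c - \<delta>) (\<Sum>\<^sub>k \<parallel>a\<^sub>k\<parallel>\<^sup>2)\<^sup>1\<^sup>/\<^sup>2\<close>.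
  Now \<open>(a\<^sub>k) \<mapsto> \<Sum>\<^sub>k P'\<^sub>k a\<^sub>k\<close> is the adjoint of \<open>y \<mapsto> (P\<^sub>k P'\<^sub>k y)\<close> from the whole space to
  the direct sum of the \<open>H\<^sub>k\<close>, and an operator whose adjoint is bounded below is onto
  (lemma \<open>solvable_if_adjoint_bounded_below\<close>).  Hence, given \<open>x\<^sub>k \<in> H'\<^sub>k\<close>, some \<open>y\<close> satisfies
  \<open>P\<^sub>k P'\<^sub>k y = P\<^sub>k x\<^sub>k\<close> for all \<open>k\<close>.

  It remains to remove \<open>P\<^sub>k\<close>.  The vector \<open>P'\<^sub>k y - x\<^sub>k\<close> lies in \<open>H'\<^sub>k\<close> and is annihilated by
  \<open>P\<^sub>k\<close>.  A tuple with a single nonzero entry shows \<open>c \<le> 1\<close>, so \<open>\<theta>\<^sub>k \<le> \<delta> < 1\<close>, and then a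
  vector of \<open>H'\<^sub>k\<close> that is orthogonal to \<open>H\<^sub>k\<close> vanishes
  (lemma \<open>zero_if_opening_less_one\<close>).  So \<open>P'\<^sub>k y = x\<^sub>k\<close>.

  Orthogonality to a subspace over the scalar field only depends on the real part of the
  inner product, so the argument is carried out over the reals
  (lemma \<open>orth_proj_real_part\<close>).
\<close>

section \<open>Projections in real Hilbert spaces\<close>

text \<open>
  The space is only known as a Banach space, so the inner product is a parameter that is
  tied to the norm by the last axiom.
\<close>

locale real_hilbert =
  fixes ip :: "'a::banach \<Rightarrow> 'a \<Rightarrow> real"
  assumes add_left: "ip (x + y) z = ip x z + ip y z"
    and scaleR_left: "ip (r *\<^sub>R x) z = r * ip x z"
    and commute: "ip x y = ip y x"
    and self: "ip x x = (norm x)\<^sup>2"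
begin

lemma add_right: "ip z (x + y) = ip z x + ip z y"
  by (metis add_left commute)

lemma scaleR_right: "ip z (r *\<^sub>R x) = r * ip z x"
  by (metis scaleR_left commute)

lemma zero_left: "ip 0 x = 0"
  using scaleR_left[of 0 0 x] by simp

lemma zero_right: "ip x 0 = 0"
  by (metis zero_left commute)

lemma diff_left: "ip (x - y) z = ip x z - ip y z"
  by (metis add_left diff_add_cancel eq_diff_eq)

lemma diff_right: "ip z (x - y) = ip z x - ip z y"
  by (metis diff_left commute)

lemma sum_right: "ip z (sum f A) = (\<Sum>k\<in>A. ip z (f k))"
  by (induction A rule: infinite_finite_induct) (simp_all add: zero_right add_right)

lemma norm_diff_sq: "(norm (x - y))\<^sup>2 = (norm x)\<^sup>2 - 2 * ip x y + (norm y)\<^sup>2"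
  by (simp add: self[symmetric] diff_left diff_right commute[of y x])

lemma norm_add_sq: "(norm (x + y))\<^sup>2 = (norm x)\<^sup>2 + 2 * ip x y + (norm y)\<^sup>2"
  by (simp add: self[symmetric] add_left add_right commute[of y x])

lemma parallelogram:
  fixes x y :: 'a
  shows "(norm (x - y))\<^sup>2 + (norm (x + y))\<^sup>2 = 2 * (norm x)\<^sup>2 + 2 * (norm y)\<^sup>2"
  by (simp add: norm_diff_sq norm_add_sq)

text \<open>
  By the parallelogram law the midpoint of two almost nearest points would be nearer than
  the distance unless the two are close to each other; so a minimizing sequence is Cauchy.
\<close>

lemma nearest_point_exists:
  fixes x :: 'a
  assumes M: "subspace M" "closed M"
  shows "\<exists>y\<in>M. \<forall>z\<in>M. norm (x - y) \<le> norm (x - z)"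
proof -
  define d where "d = infdist x M"
  have ne: "M \<noteq> {}" using subspace_0[OF M(1)] by blast
  have d0: "d \<ge> 0" by (simp add: d_def infdist_nonneg)
  have dle: "d \<le> norm (x - z)" if "z \<in> M" for z
    unfolding d_def using infdist_le[OF that, of x] by (simp add: dist_norm)
  have "\<exists>u\<in>M. (norm (x - u))\<^sup>2 < d\<^sup>2 + e" if "e > 0" for e
  proof -
    have "d < sqrt (d\<^sup>2 + e)" using d0 that by (simp add: real_less_rsqrt)
    then obtain u where "u \<in> M" "dist x u < sqrt (d\<^sup>2 + e)"
      unfolding d_def infdist_notempty[OF ne] using cINF_less_iff[OF ne bdd_below_image_dist]
      by blast
    then show ?thesis using d0 that
      by (metis dist_norm norm_ge_zero real_sqrt_less_iff real_sqrt_unique)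
  qed
  then have "\<forall>j. \<exists>u\<in>M. (norm (x - u))\<^sup>2 < d\<^sup>2 + 1 / real (Suc j)" by simp
  then obtain u where u: "\<And>j. u j \<in> M" "\<And>j. (norm (x - u j))\<^sup>2 < d\<^sup>2 + 1 / real (Suc j)"
    by metis
  have close: "(norm (u i - u j))\<^sup>2 \<le> 2 / real (Suc i) + 2 / real (Suc j)" for i j
  proof -
    have "(1/2) *\<^sub>R (u i + u j) \<in> M" using M(1) u(1) by (simp add: subspace_add subspace_scale)
    then have "d \<le> norm (x - (1/2) *\<^sub>R (u i + u j))" by (rule dle)
    also have "2 * \<dots> = norm (2 *\<^sub>R (x - (1/2) *\<^sub>R (u i + u j)))" by simp
    also have "2 *\<^sub>R (x - (1/2) *\<^sub>R (u i + u j)) = (x - u i) + (x - u j)"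
      by (simp add: algebra_simps scaleR_2)
    finally have "(2 * d)\<^sup>2 \<le> (norm ((x - u i) + (x - u j)))\<^sup>2"
      using d0 by (intro power_mono) auto
    moreover have "norm ((x - u i) - (x - u j)) = norm (u i - u j)"
      by (simp add: norm_minus_commute)
    ultimately show ?thesis
      using parallelogram[of "x - u i" "x - u j"] u(2)[of i] u(2)[of j]
      by (simp add: power2_eq_square)
  qed
  have "Cauchy u"
  proof (rule CauchyI)
    fix e :: real assume e: "e > 0"
    obtain N where N: "4 / e\<^sup>2 < real N" using reals_Archimedean2 by blast
    have "norm (u i - u j) < e" if ij: "i \<ge> N" "j \<ge> N" for i j
    proof -
      have N0: "real N > 0" using N e by (smt (verit) divide_pos_pos zero_less_power)
      have "(norm (u i - u j))\<^sup>2 \<le> 2 / real (Suc i) + 2 / real (Suc j)" by (rule close)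
      also have "\<dots> \<le> 2 / real N + 2 / real N"
        using N0 ij by (intro add_mono divide_left_mono) auto
      also have "\<dots> < e\<^sup>2" using N N0 e by (simp add: field_simps)
      finally show ?thesis using e by (simp add: power2_less_imp_less)
    qed
    then show "\<exists>N. \<forall>i\<ge>N. \<forall>j\<ge>N. norm (u i - u j) < e" by blast
  qed
  then obtain y where y: "u \<longlonglongrightarrow> y" unfolding Cauchy_convergent_iff convergent_def by blast
  have "y \<in> M" using closed_sequentially[OF M(2)] u(1) y by blast
  have "(\<lambda>j. (norm (x - u j))\<^sup>2) \<longlonglongrightarrow> (norm (x - y))\<^sup>2" by (intro tendsto_intros y)
  moreover have "(\<lambda>j. d\<^sup>2 + 1 / real (Suc j)) \<longlonglongrightarrow> d\<^sup>2 + 0"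
    by (intro tendsto_intros LIMSEQ_Suc[OF lim_const_over_n])
  ultimately have "(norm (x - y))\<^sup>2 \<le> d\<^sup>2 + 0"
    by (rule LIMSEQ_le) (use u(2) less_imp_le in blast)
  then have "norm (x - y) \<le> d" using d0 by (auto intro: power2_le_imp_le)
  with \<open>y \<in> M\<close> dle show ?thesis by (meson order_trans)
qed

text \<open>Moving a nearest point inside the subspace cannot bring it closer to \<open>x\<close>; to first
  order this says that the error is orthogonal to the subspace.\<close>

lemma nearest_point_orthogonal:
  assumes M: "subspace M" and y: "y \<in> M" "\<And>z. z \<in> M \<Longrightarrow> norm (x - y) \<le> norm (x - z)"
    and z: "z \<in> M"
  shows "ip (x - y) z = 0"
proof (cases "z = 0")
  case False
  \<comment> \<open>the step along \<open>z\<close> that minimizes the distance\<close>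
  define t where "t = ip (x - y) z / (norm z)\<^sup>2"
  have "y + t *\<^sub>R z \<in> M" using M y z by (simp add: subspace_add subspace_scale)
  from y(2)[OF this] have "(norm (x - y))\<^sup>2 \<le> (norm ((x - y) - t *\<^sub>R z))\<^sup>2"
    by (intro power_mono) (simp_all add: algebra_simps)
  then have "2 * (t * ip (x - y) z) \<le> t\<^sup>2 * (norm z)\<^sup>2"
    by (simp add: norm_diff_sq[of "x - y" "t *\<^sub>R z"] scaleR_right power_mult_distrib)
  also have "\<dots> = t * ip (x - y) z" using False by (simp add: t_def power2_eq_square)
  finally have "(ip (x - y) z)\<^sup>2 \<le> 0"
    using False by (simp add: t_def power2_eq_square field_simps)
  then show ?thesis by simp
qed (simp add: zero_right)

lemma orth_proj_eqI:
  assumes M: "subspace M" and y: "y \<in> M" "\<And>z. z \<in> M \<Longrightarrow> ip (x - y) z = 0"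
  shows "orth_proj ip M x = y"
  unfolding orth_proj_def
proof (rule the_equality)
  fix w assume w: "w \<in> M \<and> (\<forall>z\<in>M. ip (x - w) z = 0)"
  have wy: "w - y \<in> M" using M w y by (simp add: subspace_diff)
  have "ip (w - y) (w - y) = ip (x - y) (w - y) - ip (x - w) (w - y)"
    by (simp add: diff_left)
  also have "\<dots> = 0" using w y wy by simp
  finally show "w = y" by (simp add: self)
qed (use y in blast)

end

locale real_hilbert_subspace = real_hilbert ip
  for ip :: "'a::banach \<Rightarrow> 'a \<Rightarrow> real" +
  fixes M :: "'a set"
  assumes subspace: "subspace M" and closed: "closed M"
begin

abbreviation P where "P \<equiv> orth_proj ip M"

lemma proj_in: "P x \<in> M" and proj_orth: "z \<in> M \<Longrightarrow> ip (x - P x) z = 0"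
proof -
  obtain y where y: "y \<in> M" "\<forall>z\<in>M. norm (x - y) \<le> norm (x - z)"
    using nearest_point_exists[OF subspace closed] by blast
  then have o: "\<And>z. z \<in> M \<Longrightarrow> ip (x - y) z = 0"
    using nearest_point_orthogonal[OF subspace] by blast
  have "P x = y" using orth_proj_eqI[OF subspace y(1) o] .
  then show "P x \<in> M" "z \<in> M \<Longrightarrow> ip (x - P x) z = 0" using y(1) o by auto
qed

lemma proj_id: "x \<in> M \<Longrightarrow> P x = x"
  by (rule orth_proj_eqI[OF subspace]) (simp_all add: zero_left)

lemma proj_adjoint: "z \<in> M \<Longrightarrow> ip (P x) z = ip x z"
  using proj_orth[of z x] by (simp add: diff_left)

lemma proj_self_adjoint: "ip (P x) z = ip x (P z)"
  by (metis commute proj_adjoint proj_in)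

lemma norm_proj_le: "norm (P x) \<le> norm x"
proof -
  have "(norm x)\<^sup>2 = (norm (x - P x))\<^sup>2 + (norm (P x))\<^sup>2"
    using norm_add_sq[of "x - P x" "P x"] proj_orth[OF proj_in, of x x] by simp
  then have "(norm (P x))\<^sup>2 \<le> (norm x)\<^sup>2" by simp
  then show ?thesis by (rule power2_le_imp_le) simp
qed

lemma bounded_linear_proj: "bounded_linear P"
proof (rule bounded_linear_intro[where K = 1])
  show "P (x + y) = P x + P y" for x y
    by (rule orth_proj_eqI[OF subspace])
      (simp_all add: subspace_add subspace proj_in add_left diff_left proj_adjoint)
  show "P (r *\<^sub>R x) = r *\<^sub>R P x" for r x
    by (rule orth_proj_eqI[OF subspace])
      (simp_all add: subspace_scale subspace proj_in scaleR_left diff_left proj_adjoint)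
  show "norm (P x) \<le> norm x * 1" for x using norm_proj_le by simp
qed

end

context real_hilbert
begin

lemma opening_bound:
  assumes "subspace M" "closed M" "subspace N" "closed N"
  shows "norm (orth_proj ip M x - orth_proj ip N x) \<le> subspace_opening ip M N * norm x"
proof -
  interpret M: real_hilbert_subspace ip M using assms by unfold_locales
  interpret N: real_hilbert_subspace ip N using assms by unfold_locales
  show ?thesis unfolding subspace_opening_def
    by (rule onorm[OF bounded_linear_sub[OF M.bounded_linear_proj N.bounded_linear_proj]])
qed

text \<open>On such a vector the difference of the projections acts as minus the identity, which
  an operator of norm less than one can only do at zero.\<close>

lemma zero_if_opening_less_one:
  assumes "subspace M" "closed M" "subspace N" "closed N"
    and less: "subspace_opening ip M N < 1" and w: "w \<in> N" "orth_proj ip M w = 0"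
  shows "w = 0"
proof (rule ccontr)
  interpret N: real_hilbert_subspace ip N using assms by unfold_locales
  assume "w \<noteq> 0"
  have "norm w \<le> subspace_opening ip M N * norm w"
    using opening_bound[OF assms(1-4), of w] w by (simp add: N.proj_id)
  with \<open>w \<noteq> 0\<close> less show False by simp
qed

section \<open>Surjectivity from a lower bound on the adjoint\<close>

text \<open>
  The map \<open>y \<mapsto> (U\<^sub>k y)\<close> into the direct sum of the \<open>K\<^sub>k\<close> has the adjoint
  \<open>(a\<^sub>k) \<mapsto> \<Sum>\<^sub>k V\<^sub>k a\<^sub>k\<close>.  Its image is reached by gradient descent for the squared residual:
  the step \<open>g = \<Sum>\<^sub>k V\<^sub>k r\<^sub>k\<close> is the gradient at a residual \<open>(r\<^sub>k)\<close>, and the lower bound on the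
  adjoint says that the gradient is large compared with the residual.  So one step of the
  right length shrinks the residual by a constant factor, and the iterates converge
  geometrically.
\<close>

lemma solvable_if_adjoint_bounded_below:
  assumes I: "finite I" and K: "\<And>k. k \<in> I \<Longrightarrow> subspace (K k)"
    and U: "\<And>k. k \<in> I \<Longrightarrow> bounded_linear (U k)"
    and U_in: "\<And>k y. k \<in> I \<Longrightarrow> U k y \<in> K k"
    and U_le: "\<And>k y. k \<in> I \<Longrightarrow> norm (U k y) \<le> norm y"
    and adj: "\<And>k y a. k \<in> I \<Longrightarrow> a \<in> K k \<Longrightarrow> ip (U k y) a = ip y (V k a)"
    and m: "m > 0"
    and below: "\<And>a. (\<And>k. k \<in> I \<Longrightarrow> a k \<in> K k) \<Longrightarrow>
      m * (\<Sum>k\<in>I. (norm (a k))\<^sup>2) \<le> (norm (\<Sum>k\<in>I. V k (a k)))\<^sup>2"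
    and b: "\<And>k. k \<in> I \<Longrightarrow> b k \<in> K k"
  shows "\<exists>y. \<forall>k\<in>I. U k y = b k"
proof (cases "I = {}")
  case False
  define N where "N = real (card I)"
  have N: "N \<ge> 1" using I False card_gt_0_iff[of I] by (simp add: N_def Suc_le_eq)
  define g where "g y = (\<Sum>k\<in>I. V k (b k - U k y))" for y
  define F where "F y = y + (1 / N) *\<^sub>R g y" for y
  define E where "E y = (\<Sum>k\<in>I. (norm (b k - U k y))\<^sup>2)" for y
  have E0: "E y \<ge> 0" for y by (simp add: E_def sum_nonneg)
  have r_in: "b k - U k y \<in> K k" if "k \<in> I" for k y
    using K U_in b that by (simp add: subspace_diff)
  \<comment> \<open>\<open>N\<close> bounds the squared norm of \<open>y \<mapsto> (U\<^sub>k y)\<close>, hence the step length \<open>1 / N\<close>\<close>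
  have step: "E (F y) \<le> E y - (norm (g y))\<^sup>2 / N" for y
  proof -
    have "E (F y) = (\<Sum>k\<in>I. (norm ((b k - U k y) - (1 / N) *\<^sub>R U k (g y)))\<^sup>2)"
      unfolding E_def F_def using U
      by (intro sum.cong refl) (simp add: bounded_linear.linear linear_add linear_scale diff_diff_eq)
    also have "\<dots> = (\<Sum>k\<in>I. (norm (b k - U k y))\<^sup>2 - 2 / N * ip (g y) (V k (b k - U k y))
        + (norm (U k (g y)))\<^sup>2 / N\<^sup>2)"
      using r_in
      by (intro sum.cong refl)
        (simp add: norm_diff_sq scaleR_right commute[of _ "U _ (g y)"] adj power_divide)
    also have "\<dots> = E y - 2 / N * ip (g y) (g y) + (\<Sum>k\<in>I. (norm (U k (g y)))\<^sup>2) / N\<^sup>2"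
      by (simp only: sum.distrib sum_subtractf E_def sum_divide_distrib[symmetric]
          sum_distrib_left[symmetric] sum_right[symmetric] g_def[symmetric])
    also have "\<dots> \<le> E y - 2 / N * (norm (g y))\<^sup>2 + (N * (norm (g y))\<^sup>2) / N\<^sup>2"
      using sum_bounded_above[of I "\<lambda>k. (norm (U k (g y)))\<^sup>2" "(norm (g y))\<^sup>2"] U_le
      by (simp add: self N_def divide_right_mono power_mono)
    also have "\<dots> = E y - (norm (g y))\<^sup>2 / N"
      using N by (simp add: field_simps power2_eq_square)
    finally show ?thesis .
  qed
  \<comment> \<open>\<open>1 - m / N\<close> can only be negative when all residuals vanish\<close>
  define q where "q = max 0 (1 - m / N)"
  have q: "0 \<le> q" "q < 1" using m N by (auto simp: q_def)
  have contract: "E (F y) \<le> q * E y" for y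
  proof -
    have "m * E y \<le> (norm (g y))\<^sup>2" unfolding E_def g_def by (rule below) (rule r_in)
    then have "m * E y / N \<le> (norm (g y))\<^sup>2 / N" using N by (simp add: divide_right_mono)
    then have "E (F y) \<le> (1 - m / N) * E y" using step[of y] by (simp add: algebra_simps)
    also have "\<dots> \<le> q * E y" using E0 by (intro mult_right_mono) (auto simp: q_def)
    finally show ?thesis .
  qed
  define s where "s j = (F ^^ j) 0" for j
  have s_Suc: "s (Suc j) = F (s j)" for j by (simp add: s_def)
  have Es: "E (s j) \<le> q ^ j * E 0" for j
  proof (induction j)
    case (Suc j)
    have "E (s (Suc j)) \<le> q * E (s j)" unfolding s_Suc by (rule contract)
    also have "\<dots> \<le> q * (q ^ j * E 0)" using Suc q(1) by (rule mult_left_mono)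
    finally show ?case by (simp add: mult.assoc)
  qed (simp add: s_def)
  have incr: "norm (s (Suc j) - s j) \<le> sqrt q ^ j * sqrt (E 0)" for j
  proof -
    have "(norm (g (s j)))\<^sup>2 / N \<le> E (s j)" using step[of "s j"] E0[of "F (s j)"] by simp
    then have "(norm (g (s j)) / N)\<^sup>2 \<le> E (s j) / N"
      using N divide_right_mono[of "(norm (g (s j)))\<^sup>2 / N" "E (s j)" N]
      by (simp add: power_divide power2_eq_square)
    also have "\<dots> \<le> E (s j)" using N E0[of "s j"] by (simp add: divide_le_eq mult_le_cancel_left1)
    also have "\<dots> \<le> q ^ j * E 0" by (rule Es)
    finally have "norm (g (s j)) / N \<le> sqrt (q ^ j * E 0)" by (rule real_le_rsqrt)
    then show ?thesis using N by (simp add: s_Suc F_def real_sqrt_mult real_sqrt_power)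
  qed
  have "summable (\<lambda>j. s (Suc j) - s j)"
    by (rule summable_comparison_test'[OF summable_mult2[OF summable_geometric] incr])
      (use q in simp)
  then have "convergent s"
    by (simp only: summable_iff_convergent sum_lessThan_telescope convergent_diff_const_right_iff)
  then obtain y where y: "s \<longlonglongrightarrow> y" unfolding convergent_def by blast
  have "U k y = b k" if k: "k \<in> I" for k
  proof -
    have "(\<lambda>j. (norm (b k - U k (s j)))\<^sup>2) \<longlonglongrightarrow> (norm (b k - U k y))\<^sup>2"
      by (intro tendsto_intros bounded_linear.tendsto[OF U[OF k]] y)
    moreover have "(\<lambda>j. q ^ j * E 0) \<longlonglongrightarrow> 0 * E 0"
      using q by (intro tendsto_intros LIMSEQ_power_zero) simp
    moreover have "(norm (b k - U k (s j)))\<^sup>2 \<le> q ^ j * E 0" for j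
      using Es[of j] member_le_sum[OF k, of "\<lambda>k. (norm (b k - U k (s j)))\<^sup>2"] I
      by (simp add: E_def)
    ultimately have "(norm (b k - U k y))\<^sup>2 \<le> 0 * E 0" by (blast intro: LIMSEQ_le)
    then show ?thesis by simp
  qed
  then show ?thesis by blast
qed simp

section \<open>Stability over the reals\<close>

text \<open>
  Replacing \<open>a\<^sub>k = P\<^sub>k a\<^sub>k\<close> by \<open>P'\<^sub>k a\<^sub>k\<close> costs at most \<open>\<theta>\<^sub>k \<parallel>a\<^sub>k\<parallel>\<close> in each summand, and the
  Cauchy-Schwarz inequality collects these costs.
\<close>

lemma projected_sum_bounded_below:
  assumes H: "\<And>k. k \<in> I \<Longrightarrow> subspace (H k)" "\<And>k. k \<in> I \<Longrightarrow> closed (H k)"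
    and H': "\<And>k. k \<in> I \<Longrightarrow> subspace (H' k)" "\<And>k. k \<in> I \<Longrightarrow> closed (H' k)"
    and a: "\<And>k. k \<in> I \<Longrightarrow> a k \<in> H k"
    and c: "c * L2_set (\<lambda>k. norm (a k)) I \<le> norm (\<Sum>k\<in>I. a k)"
  shows "(c - L2_set (\<lambda>k. subspace_opening ip (H k) (H' k)) I) * L2_set (\<lambda>k. norm (a k)) I
    \<le> norm (\<Sum>k\<in>I. orth_proj ip (H' k) (a k))"
proof -
  define \<theta> where "\<theta> k = subspace_opening ip (H k) (H' k)" for k
  have le: "norm (a k - orth_proj ip (H' k) (a k)) \<le> \<bar>\<theta> k\<bar> * \<bar>norm (a k)\<bar>" if k: "k \<in> I" for k
  proof -
    interpret real_hilbert_subspace ip "H k" using H k by unfold_locales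
    have "norm (a k - orth_proj ip (H' k) (a k)) \<le> \<theta> k * norm (a k)"
      using opening_bound[OF H(1,2)[OF k] H'(1,2)[OF k], of "a k"] proj_id[OF a[OF k]]
      by (simp add: \<theta>_def)
    also have "\<dots> \<le> \<bar>\<theta> k\<bar> * \<bar>norm (a k)\<bar>" by (simp add: mult_right_mono)
    finally show ?thesis .
  qed
  have "norm (\<Sum>k\<in>I. a k) - norm (\<Sum>k\<in>I. orth_proj ip (H' k) (a k))
      \<le> norm (\<Sum>k\<in>I. a k - orth_proj ip (H' k) (a k))"
    by (simp add: sum_subtractf norm_triangle_ineq2)
  also have "\<dots> \<le> (\<Sum>k\<in>I. \<bar>\<theta> k\<bar> * \<bar>norm (a k)\<bar>)" by (rule sum_norm_le) (rule le)
  also have "\<dots> \<le> L2_set \<theta> I * L2_set (\<lambda>k. norm (a k)) I" by (rule L2_set_mult_ineq)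
  finally show ?thesis using c by (simp add: algebra_simps \<theta>_def[abs_def])
qed

lemma IBAP_stable:
  assumes H: "\<And>k. k \<in> {1..n} \<Longrightarrow> subspace (H k)" "\<And>k. k \<in> {1..n} \<Longrightarrow> closed (H k)"
    and H': "\<And>k. k \<in> {1..n} \<Longrightarrow> subspace (H' k)" "\<And>k. k \<in> {1..n} \<Longrightarrow> closed (H' k)"
    and c: "\<And>a. (\<And>k. k \<in> {1..n} \<Longrightarrow> a k \<in> H k) \<Longrightarrow>
      c * L2_set (\<lambda>k. norm (a k)) {1..n} \<le> norm (\<Sum>k=1..n. a k)"
    and "c \<le> 1"
    and less: "L2_set (\<lambda>k. subspace_opening ip (H k) (H' k)) {1..n} < c"
  shows "IBAP ip n H'"
  unfolding IBAP_def
proof (intro allI impI)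
  fix x assume x: "\<forall>k\<in>{1..n}. x k \<in> H' k"
  let ?P = "\<lambda>k. orth_proj ip (H k)" and ?P' = "\<lambda>k. orth_proj ip (H' k)"
  let ?\<delta> = "L2_set (\<lambda>k. subspace_opening ip (H k) (H' k)) {1..n}"
  have P: "real_hilbert_subspace ip (H k)" if "k \<in> {1..n}" for k
    using H that by unfold_locales
  have P': "real_hilbert_subspace ip (H' k)" if "k \<in> {1..n}" for k
    using H' that by unfold_locales
  have "\<exists>y. \<forall>k\<in>{1..n}. ?P k (?P' k y) = ?P k (x k)"
  proof (rule solvable_if_adjoint_bounded_below[where V = ?P' and K = H and m = "(c - ?\<delta>)\<^sup>2"])
    fix k y a assume k: "k \<in> {1..n}"
    interpret P: real_hilbert_subspace ip "H k" by (rule P[OF k])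
    interpret P': real_hilbert_subspace ip "H' k" by (rule P'[OF k])
    show "bounded_linear (\<lambda>y. ?P k (?P' k y))"
      by (rule bounded_linear_compose[OF P.bounded_linear_proj P'.bounded_linear_proj])
    show "?P k (?P' k y) \<in> H k" "?P k (x k) \<in> H k" by (rule P.proj_in)+
    show "norm (?P k (?P' k y)) \<le> norm y"
      by (rule order_trans[OF P.norm_proj_le P'.norm_proj_le])
    show "ip (?P k (?P' k y)) a = ip y (?P' k a)" if "a \<in> H k"
      by (simp add: P.proj_adjoint[OF that] P'.proj_self_adjoint)
  next
    fix a assume a: "\<And>k. k \<in> {1..n} \<Longrightarrow> a k \<in> H k"
    have "(c - ?\<delta>) * L2_set (\<lambda>k. norm (a k)) {1..n} \<le> norm (\<Sum>k=1..n. ?P' k (a k))"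
      by (rule projected_sum_bounded_below[OF H H' a c[OF a]])
    then have "((c - ?\<delta>) * L2_set (\<lambda>k. norm (a k)) {1..n})\<^sup>2 \<le> (norm (\<Sum>k=1..n. ?P' k (a k)))\<^sup>2"
      using less by (intro power_mono) auto
    then show "(c - ?\<delta>)\<^sup>2 * (\<Sum>k=1..n. (norm (a k))\<^sup>2) \<le> (norm (\<Sum>k=1..n. ?P' k (a k)))\<^sup>2"
      by (simp add: power_mult_distrib L2_set_def sum_nonneg)
  qed (use H less in auto)
  then obtain y where y: "\<And>k. k \<in> {1..n} \<Longrightarrow> ?P k (?P' k y) = ?P k (x k)" by blast
  have "?P' k y = x k" if k: "k \<in> {1..n}" for k
  proof -
    interpret P: real_hilbert_subspace ip "H k" by (rule P[OF k])
    interpret P': real_hilbert_subspace ip "H' k" by (rule P'[OF k])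
    have "subspace_opening ip (H k) (H' k) < 1"
      using member_le_L2_set[OF _ k, of "\<lambda>k. subspace_opening ip (H k) (H' k)"] less \<open>c \<le> 1\<close> by simp
    moreover have "?P' k y - x k \<in> H' k"
      using x k P'.proj_in P'.subspace by (simp add: subspace_diff)
    moreover have "?P k (?P' k y - x k) = 0"
      using y[OF k] by (simp add: bounded_linear.linear[OF P.bounded_linear_proj] linear_diff)
    ultimately have "?P' k y - x k = 0"
      using zero_if_opening_less_one[OF P.subspace P.closed P'.subspace P'.closed] by blast
    then show ?thesis by simp
  qed
  then show "\<exists>y. \<forall>k\<in>{1..n}. ?P' k y = x k" by blast
qed

end

section \<open>Reduction to the real part of the inner product\<close>

context hilbert_space
begin

text \<open>The real part of the inner product, written through the norm because the scalar field
  has no real part function.\<close>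

definition rip :: "'a \<Rightarrow> 'a \<Rightarrow> real" where
  "rip x y = ((norm (x + y))\<^sup>2 - (norm x)\<^sup>2 - (norm y)\<^sup>2) / 2"

lemma ip_add_right: "ip z (x + y) = ip z x + ip z y"
  by (metis ip_add_left ip_commute conjg_add)

lemma of_real_rip: "of_real (2 * rip x y) = ip x y + ip y x"
proof -
  have "of_real ((norm (x + y))\<^sup>2) =
      of_real ((norm x)\<^sup>2) + of_real ((norm y)\<^sup>2) + (ip x y + ip y x)"
    unfolding ip_self[symmetric] by (simp add: ip_add_left ip_add_right)
  then show ?thesis by (simp add: rip_def)
qed

lemma ip_scaleR_right: "ip y (r *\<^sub>R x) = of_real r * ip y x"
proof -
  have "ip y (scl (of_real r) x) = conjg (of_real r * ip x y)"
    by (simp add: ip_commute[of y "scl (of_real r) x"] ip_scale_left)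
  then show ?thesis
    by (simp add: scale_of_real conjg_mult conjg_of_real ip_commute[of y x])
qed

lemma real_hilbert_rip: "real_hilbert rip"
proof
  have inj: "u = v" if "(of_real (2 * u) :: 'k) = of_real (2 * v)" for u v :: real
    using that unfolding of_real_eq_iff by simp
  show "rip (x + y) z = rip x z + rip y z" for x y z
    by (rule inj) (simp only: distrib_left of_real_add of_real_rip ip_add_left ip_add_right
        add.assoc add.left_commute)
  show "rip (r *\<^sub>R x) z = r * rip x z" for r x z
  proof (rule inj)
    have "ip (r *\<^sub>R x) z = of_real r * ip x z" by (metis ip_scale_left scale_of_real)
    then have "of_real (2 * rip (r *\<^sub>R x) z) = of_real r * (ip x z + ip z x)"
      by (simp only: of_real_rip ip_scaleR_right distrib_left)
    also have "\<dots> = of_real (2 * (r * rip x z))"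
      by (simp only: of_real_rip[symmetric] of_real_mult[symmetric] mult.left_commute)
    finally show "of_real (2 * rip (r *\<^sub>R x) z) = (of_real (2 * (r * rip x z)) :: 'k)" .
  qed
  show "rip x y = rip y x" for x y by (simp add: rip_def add.commute)
  show "rip x x = (norm x)\<^sup>2" for x
    by (rule inj) (subst of_real_rip, simp only: ip_self of_real_add[symmetric] mult_2)
qed

lemma closed_subspace_real:
  assumes "closed_subspace scl M"
  shows "Real_Vector_Spaces.subspace M" "closed M"
proof -
  have M: "subspace M" "closed M" using assms by (auto simp: closed_subspace_def)
  show "closed M" by fact
  show "Real_Vector_Spaces.subspace M"
    using M(1) by (intro real_vector.subspaceI)
      (auto simp: subspace_0 subspace_add scale_of_real[symmetric] subspace_scale)
qed

text \<open>A scalar subspace that contains \<open>z\<close> also contains \<open>\<langle>w, z\<rangle> z\<close>, and the inner product of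
  \<open>w\<close> with this vector is the real number \<open>\<bar>\<langle>w, z\<rangle>\<bar>\<^sup>2\<close>.\<close>

lemma orthogonal_iff_rip:
  assumes "closed_subspace scl M"
  shows "(\<forall>z\<in>M. ip w z = 0) \<longleftrightarrow> (\<forall>z\<in>M. rip w z = 0)"
proof (intro iffI ballI)
  fix z assume ip0: "\<forall>z\<in>M. ip w z = 0" and z: "z \<in> M"
  have "conjg 0 = (0 :: 'k)" using conjg_of_real[of 0, where 'k = 'k] by simp
  then have "ip z w = 0" using ip0 z ip_commute[of z w] by simp
  then show "rip w z = 0" using of_real_rip[of w z] ip0 z by simp
next
  fix z assume rip0: "\<forall>z\<in>M. rip w z = 0" and z: "z \<in> M"
  define v where "v = scl (ip w z) z"
  have "v \<in> M" using assms z by (simp add: v_def closed_subspace_def subspace_scale)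
  have vw: "ip v w = of_real ((norm (ip w z))\<^sup>2)"
    unfolding v_def ip_scale_left ip_commute[of z w] by (rule mult_conjg)
  then have "ip w v = of_real ((norm (ip w z))\<^sup>2)" using ip_commute[of w v] conjg_of_real by metis
  with vw have "of_real (2 * rip w v) = (of_real (2 * (norm (ip w z))\<^sup>2) :: 'k)"
    by (subst of_real_rip) (simp only: of_real_add[symmetric] mult_2)
  then have "rip w v = (norm (ip w z))\<^sup>2" unfolding of_real_eq_iff by simp
  then show "ip w z = 0" using rip0 \<open>v \<in> M\<close> by simp
qed

lemma orth_proj_real_part:
  "closed_subspace scl M \<Longrightarrow> orth_proj ip M = orth_proj rip M"
  by (rule ext) (simp add: orth_proj_def orthogonal_iff_rip)

end

section \<open>Stability of the inverse best approximation property\<close>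

theorem theorem4p4:
  fixes scl :: "'k::scalar_field \<Rightarrow> 'a::banach \<Rightarrow> 'a"
    and ip :: "'a \<Rightarrow> 'a \<Rightarrow> 'k"
    and n :: nat
    and H H' :: "nat \<Rightarrow> 'a set"
    and c :: real
  assumes "hilbert_space scl ip"
    and "\<forall>k\<in>{1..n}. closed_subspace scl (H k)"
    and "\<exists>k\<in>{1..n}. H k \<noteq> {0}"
    and "IBAP ip n H"
    and "c = Inf {norm (\<Sum>k=1..n. x k) / sqrt (\<Sum>k=1..n. (norm (x k))\<^sup>2) | x.
                    (\<forall>k\<in>{1..n}. x k \<in> H k) \<and> (\<exists>k\<in>{1..n}. x k \<noteq> 0)}"
    and "\<forall>k\<in>{1..n}. closed_subspace scl (H' k)"
    and "(\<Sum>k=1..n. (subspace_opening ip (H k) (H' k))\<^sup>2) < c\<^sup>2"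
  shows "IBAP ip n H'"
proof -
  interpret hilbert_space scl ip by (rule assms(1))
  interpret R: real_hilbert rip by (rule real_hilbert_rip)
  have H: "Real_Vector_Spaces.subspace (H k)" "closed (H k)" if "k \<in> {1..n}" for k
    using assms(2) that closed_subspace_real by blast+
  have H': "Real_Vector_Spaces.subspace (H' k)" "closed (H' k)" if "k \<in> {1..n}" for k
    using assms(6) that closed_subspace_real by blast+
  define Q where "Q x = norm (\<Sum>k=1..n. x k) / L2_set (\<lambda>k. norm (x k)) {1..n}" for x :: "nat \<Rightarrow> 'a"
  define X where "X = {x. (\<forall>k\<in>{1..n}. x k \<in> H k) \<and> (\<exists>k\<in>{1..n}. x k \<noteq> 0)}"
  have c_def: "c = Inf (Q ` X)"
    by (simp only: assms(5) X_def image_Collect Q_def L2_set_def)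
  have Q0: "Q x \<ge> 0" for x by (simp add: Q_def)
  have c_le: "c \<le> Q x" if "x \<in> X" for x
    unfolding c_def using that Q0 by (intro cInf_lower bdd_belowI[where m = 0]) auto
  \<comment> \<open>a tuple with a single nonzero entry has quotient one\<close>
  obtain k0 where "k0 \<in> {1..n}" "H k0 \<noteq> {0}" using assms(3) by blast
  moreover from this obtain v where "v \<in> H k0" "v \<noteq> 0"
    using Real_Vector_Spaces.subspace_0[OF H(1)[OF \<open>k0 \<in> {1..n}\<close>]] by blast
  ultimately have k0: "k0 \<in> {1..n}" "v \<in> H k0" "v \<noteq> 0" by auto
  define e where "e k = (if k = k0 then v else 0)" for k
  have eX: "e \<in> X" using k0 H(1) by (auto simp: X_def e_def Real_Vector_Spaces.subspace_0)
  have "(norm (e k))\<^sup>2 = (if k = k0 then (norm v)\<^sup>2 else 0)" for k by (simp add: e_def)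
  then have "Q e = 1" using k0 by (simp add: Q_def L2_set_def) (simp add: e_def)
  then have c1: "c \<le> 1" using c_le[OF eX] by simp
  have c0: "c \<ge> 0" unfolding c_def using eX Q0 by (intro cInf_greatest) auto
  have bound: "c * L2_set (\<lambda>k. norm (a k)) {1..n} \<le> norm (\<Sum>k=1..n. a k)"
    if a: "\<And>k. k \<in> {1..n} \<Longrightarrow> a k \<in> H k" for a
  proof (cases "a \<in> X")
    case True
    then have "L2_set (\<lambda>k. norm (a k)) {1..n} \<noteq> 0"
      by (auto simp: X_def L2_set_eq_0_iff)
    then have "L2_set (\<lambda>k. norm (a k)) {1..n} > 0"
      by (simp add: order_less_le)
    then show ?thesis using c_le[OF True] by (simp add: Q_def field_simps)
  next
    case False
    then have "\<And>k. k \<in> {1..n} \<Longrightarrow> a k = 0" using a by (auto simp: X_def)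
    then show ?thesis by (simp add: L2_set_def)
  qed
  have op: "subspace_opening ip (H k) (H' k) = subspace_opening rip (H k) (H' k)"
    if "k \<in> {1..n}" for k
    using that assms(2,6) by (simp add: subspace_opening_def orth_proj_real_part)
  have "(L2_set (\<lambda>k. subspace_opening rip (H k) (H' k)) {1..n})\<^sup>2 < c\<^sup>2"
    using assms(7) op by (simp add: L2_set_def sum_nonneg)
  then have "L2_set (\<lambda>k. subspace_opening rip (H k) (H' k)) {1..n} < c"
    using c0 by (rule power2_less_imp_less)
  from R.IBAP_stable[OF H H' bound c1 this] have "IBAP rip n H'" .
  then show ?thesis
    using assms(6) by (simp add: IBAP_def orth_proj_real_part)
qed

end
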